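(* Let $\lambda,\mu,\nu,\alpha,\beta$ be real numbers with $\lambda,\mu,\nu>0$, $\alpha>\beta>0$ and $\rho:=\lambda/\mu<1$. For non-negative integers $Q,L$ define the anticipated costs $$C(a=1)=\alpha\frac{Q}{\mu},\qquad C(a=2)=\frac{\beta}{\nu}+\frac{\alpha}{\mu}\left(Q+L-\frac{\mu-\lambda}{\nu}\right)^+ ,$$ and suppose that a customer who observes $(Q,L)$ on arrival chooses the lounge ($a=2$) if $C(a=1)>C(a=2)$, and the queue ($a=1$) otherwise. Let $\Delta:=1-\beta/\alpha$. If $\rho\ge\Delta$, then customers always choose to join the queue, i.e. the choice is $a=1$ for every pair of non-negative integers $(Q,L)$.
   Context: Model: single-server queue with a lounge; Poisson arrivals of rate $\lambda$, exponential service times of rate $\mu$, exponential lounge stays of rate $\nu$; waiting costs $\alpha$ per unit time in the queue and $\beta$ per unit time in the lounge. An arriving customer observes the queue length $Q$ and the lounge size $L$, and chooses $a=1$ (join the queue directly) or $a=2$ (first go to the lounge, then join the queue); ties are broken in favour of $a=1$. Here $x^+=\max\{x,0\}$. *)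

theory Defs
  imports Complex_Main
begin

text \<open>
  Single-server queue with a lounge: arrival rate \<open>lam\<close>, service rate \<open>mu\<close>, rate \<open>nu\<close> of the
  exponential lounge stay, and waiting costs per unit time \<open>\<alpha>\<close> in the queue and \<open>\<beta>\<close> in the lounge.
\<close>

datatype action = Queue  \<comment> \<open>\<open>a = 1\<close>: join the queue directly\<close>
  | Lounge  \<comment> \<open>\<open>a = 2\<close>: go to the lounge first, then join the queue\<close>

fun anticipated_cost ::
    "real \<Rightarrow> real \<Rightarrow> real \<Rightarrow> real \<Rightarrow> real \<Rightarrow> nat \<Rightarrow> nat \<Rightarrow> action \<Rightarrow> real" where
  "anticipated_cost lam mu nu \<alpha> \<beta> Q L Queue = \<alpha> * (real Q / mu)"
| "anticipated_cost lam mu nu \<alpha> \<beta> Q L Lounge =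
     \<beta> / nu + \<alpha> / mu * max (real Q + real L - (mu - lam) / nu) 0"

definition customer_choice ::
    "real \<Rightarrow> real \<Rightarrow> real \<Rightarrow> real \<Rightarrow> real \<Rightarrow> nat \<Rightarrow> nat \<Rightarrow> action" where
  "customer_choice lam mu nu \<alpha> \<beta> Q L =
     (if anticipated_cost lam mu nu \<alpha> \<beta> Q L Queue > anticipated_cost lam mu nu \<alpha> \<beta> Q L Lounge
      then Lounge else Queue)"

end

theory Submission
  imports Defs
begin

text \<open>
  Bounding the positive part below by its argument, the cost of the lounge exceeds that of the queue
  by at least \<open>(\<beta> - \<alpha> (1 - \<rho>)) / nu\<close>, which is nonnegative exactly when \<open>\<rho> \<ge> 1 - \<beta> / \<alpha>\<close>.
\<close>

theorem corollary1:
  fixes lam mu nu \<alpha> \<beta> \<rho> \<Delta> :: real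
  assumes "lam > 0" and "mu > 0" and "nu > 0"
    and "\<alpha> > \<beta>" and "\<beta> > 0"
    and "\<rho> = lam / mu" and "\<rho> < 1"
    and "\<Delta> = 1 - \<beta> / \<alpha>"
    and "\<rho> \<ge> \<Delta>"
  shows "\<forall>Q L :: nat. customer_choice lam mu nu \<alpha> \<beta> Q L = Queue"
proof (intro allI)
  fix Q L :: nat
  have \<alpha>: "\<alpha> > 0" using assms by linarith
  \<comment> \<open>This is \<open>\<rho> \<ge> \<Delta>\<close> rearranged to
    \<open>1 - \<rho> \<le> \<beta> / \<alpha>\<close> and scaled so that the right side becomes
    \<open>\<beta>\<close>.\<close>
  have "\<alpha> * (1 - \<rho>) \<le> \<alpha> * (\<beta> / \<alpha>)"
    using assms \<alpha> by (intro mult_left_mono) auto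
  then have "\<alpha> * (1 - \<rho>) / nu \<le> \<beta> / nu"
    using \<alpha> \<open>nu > 0\<close> by (simp add: divide_right_mono)
  moreover have "\<alpha> * (1 - \<rho>) / nu = \<alpha> / mu * ((mu - lam) / nu)"
    using assms by (simp add: field_simps)
  \<comment> \<open>Once the product is distributed, its terms are atoms and the goal is
    linear.\<close>
  ultimately have "\<alpha> / mu * real Q \<le> \<beta> / nu + \<alpha> / mu * (real Q - (mu - lam) / nu)"
    unfolding right_diff_distrib[of "\<alpha> / mu" "real Q"] by linarith
  \<comment> \<open>Besides the positive part, this uses \<open>real L \<ge> 0\<close>.\<close>
  also have "\<dots> \<le> \<beta> / nu + \<alpha> / mu * max (real Q + real L - (mu - lam) / nu) 0"
    using \<alpha> \<open>mu > 0\<close> by (intro add_left_mono mult_left_mono) auto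
  \<comment> \<open>A weak inequality suffices, since ties go to \<open>Queue\<close>.\<close>
  finally show "customer_choice lam mu nu \<alpha> \<beta> Q L = Queue"
    by (simp add: customer_choice_def)
qed

end
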